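(* There exists a triassociative algebra $(T,\vdash,\dashv,\perp)$ such that the associative algebras $(T,\vdash)$ and $(T,\dashv)$ are both nilpotent but the associative algebra $(T,\perp)$ is not nilpotent.
   Context: A triassociative algebra $(T,\vdash,\dashv,\perp)$ is a vector space $T$ over a field with three bilinear products $\vdash,\dashv,\perp:T\times T\to T$ satisfying, for all $x,y,z\in T$: (A1) $(x\vdash y)\vdash z=x\vdash(y\vdash z)$; (A2) $(x\dashv y)\dashv z=x\dashv(y\dashv z)$; (D1) $(x\dashv y)\vdash z=x\vdash(y\vdash z)$; (D2) $(x\dashv y)\dashv z=x\dashv(y\vdash z)$; (S1) $(x\vdash y)\dashv z=x\vdash(y\dashv z)$; (T1) $(x\perp y)\vdash z=x\vdash(y\vdash z)$; (T2) $(x\dashv y)\dashv z=x\dashv(y\perp z)$; (T3) $(x\vdash y)\perp z=x\vdash(y\perp z)$; (T4) $(x\perp y)\dashv z=x\perp(y\dashv z)$; (S2) $(x\dashv y)\perp z=x\perp(y\vdash z)$; (A3) $(x\perp y)\perp z=x\perp(y\perp z)$. In particular $(T,\vdash)$, $(T,\dashv)$, $(T,\perp)$ are (not necessarily unital) associative algebras. An associative algebra $A$ is nilpotent if $A^n=0$ for some $n\in\mathbb{N}$, where $A^n$ is the ideal generated by all $n$-fold products of elements of $A$. *)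

theory Defs
  imports "HOL-Algebra.Module"
begin

text \<open>
  A vector space over a field \<open>K\<close> is a module over \<open>K\<close>. The library's \<open>module\<close> record also
  carries the ring fields \<open>mult\<close> and \<open>one\<close>, but the locale \<open>module\<close> puts no condition on them for
  the module argument; the products of an algebra are separate parameters here.
\<close>

locale vector_space_over = field K + module K V
  for K (structure) and V (structure)

locale bilinear_product = vector_space_over K A
  for K (structure) and A (structure) +
  fixes prd :: "'b \<Rightarrow> 'b \<Rightarrow> 'b"
  assumes closed: "\<lbrakk>x \<in> carrier A; y \<in> carrier A\<rbrakk> \<Longrightarrow> prd x y \<in> carrier A"
    and add_left: "\<lbrakk>x \<in> carrier A; y \<in> carrier A; z \<in> carrier A\<rbrakk>
      \<Longrightarrow> prd (x \<oplus>\<^bsub>A\<^esub> y) z = prd x z \<oplus>\<^bsub>A\<^esub> prd y z"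
    and add_right: "\<lbrakk>x \<in> carrier A; y \<in> carrier A; z \<in> carrier A\<rbrakk>
      \<Longrightarrow> prd x (y \<oplus>\<^bsub>A\<^esub> z) = prd x y \<oplus>\<^bsub>A\<^esub> prd x z"
    and smult_left: "\<lbrakk>a \<in> carrier K; x \<in> carrier A; y \<in> carrier A\<rbrakk>
      \<Longrightarrow> prd (a \<odot>\<^bsub>A\<^esub> x) y = a \<odot>\<^bsub>A\<^esub> prd x y"
    and smult_right: "\<lbrakk>a \<in> carrier K; x \<in> carrier A; y \<in> carrier A\<rbrakk>
      \<Longrightarrow> prd x (a \<odot>\<^bsub>A\<^esub> y) = a \<odot>\<^bsub>A\<^esub> prd x y"

text \<open>Associative algebras are not assumed to be unital.\<close>

locale associative_algebra = bilinear_product K A prd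
  for K (structure) and A (structure) and prd :: "'b \<Rightarrow> 'b \<Rightarrow> 'b" +
  assumes assoc: "\<lbrakk>x \<in> carrier A; y \<in> carrier A; z \<in> carrier A\<rbrakk>
      \<Longrightarrow> prd (prd x y) z = prd x (prd y z)"

locale triassociative_algebra =
  vector_space_over K T +
  L: bilinear_product K T lprd + R: bilinear_product K T rprd + P: bilinear_product K T pprd
  for K (structure) and T (structure)
    and lprd :: "'b \<Rightarrow> 'b \<Rightarrow> 'b"  (infixl \<open>\<turnstile>\<close> 70)
    and rprd :: "'b \<Rightarrow> 'b \<Rightarrow> 'b"  (infixl \<open>\<stileturn>\<close> 70)
    and pprd :: "'b \<Rightarrow> 'b \<Rightarrow> 'b"  (infixl \<open>\<perp>\<close> 70) +
  assumes
    A1: "\<lbrakk>x \<in> carrier T; y \<in> carrier T; z \<in> carrier T\<rbrakk> \<Longrightarrow> (x \<turnstile> y) \<turnstile> z = x \<turnstile> (y \<turnstile> z)" and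
    A2: "\<lbrakk>x \<in> carrier T; y \<in> carrier T; z \<in> carrier T\<rbrakk> \<Longrightarrow> (x \<stileturn> y) \<stileturn> z = x \<stileturn> (y \<stileturn> z)" and
    D1: "\<lbrakk>x \<in> carrier T; y \<in> carrier T; z \<in> carrier T\<rbrakk> \<Longrightarrow> (x \<stileturn> y) \<turnstile> z = x \<turnstile> (y \<turnstile> z)" and
    D2: "\<lbrakk>x \<in> carrier T; y \<in> carrier T; z \<in> carrier T\<rbrakk> \<Longrightarrow> (x \<stileturn> y) \<stileturn> z = x \<stileturn> (y \<turnstile> z)" and
    S1: "\<lbrakk>x \<in> carrier T; y \<in> carrier T; z \<in> carrier T\<rbrakk> \<Longrightarrow> (x \<turnstile> y) \<stileturn> z = x \<turnstile> (y \<stileturn> z)" and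
    T1: "\<lbrakk>x \<in> carrier T; y \<in> carrier T; z \<in> carrier T\<rbrakk> \<Longrightarrow> (x \<perp> y) \<turnstile> z = x \<turnstile> (y \<turnstile> z)" and
    T2: "\<lbrakk>x \<in> carrier T; y \<in> carrier T; z \<in> carrier T\<rbrakk> \<Longrightarrow> (x \<stileturn> y) \<stileturn> z = x \<stileturn> (y \<perp> z)" and
    T3: "\<lbrakk>x \<in> carrier T; y \<in> carrier T; z \<in> carrier T\<rbrakk> \<Longrightarrow> (x \<turnstile> y) \<perp> z = x \<turnstile> (y \<perp> z)" and
    T4: "\<lbrakk>x \<in> carrier T; y \<in> carrier T; z \<in> carrier T\<rbrakk> \<Longrightarrow> (x \<perp> y) \<stileturn> z = x \<perp> (y \<stileturn> z)" and
    S2: "\<lbrakk>x \<in> carrier T; y \<in> carrier T; z \<in> carrier T\<rbrakk> \<Longrightarrow> (x \<stileturn> y) \<perp> z = x \<perp> (y \<turnstile> z)" and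
    A3: "\<lbrakk>x \<in> carrier T; y \<in> carrier T; z \<in> carrier T\<rbrakk> \<Longrightarrow> (x \<perp> y) \<perp> z = x \<perp> (y \<perp> z)"
begin

lemma associative_lprd: "associative_algebra K T lprd"
  by (intro associative_algebra.intro associative_algebra_axioms.intro L.bilinear_product_axioms A1)

lemma associative_rprd: "associative_algebra K T rprd"
  by (intro associative_algebra.intro associative_algebra_axioms.intro R.bilinear_product_axioms A2)

lemma associative_pprd: "associative_algebra K T pprd"
  by (intro associative_algebra.intro associative_algebra_axioms.intro P.bilinear_product_axioms A3)

end

context associative_algebra
begin

text \<open>
  The library's \<open>ideal\<close> and \<open>genideal\<close> require a unital ring, so two-sided ideals of a possibly
  non-unital algebra are defined here.
\<close>

definition algebra_ideal :: "'b set \<Rightarrow> bool" where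
  "algebra_ideal I \<longleftrightarrow> submodule I K A \<and>
     (\<forall>x \<in> carrier A. \<forall>y \<in> I. prd x y \<in> I \<and> prd y x \<in> I)"

definition generated_ideal :: "'b set \<Rightarrow> 'b set" where
  "generated_ideal S = \<Inter> {I. algebra_ideal I \<and> S \<subseteq> I}"

text \<open>
  By associativity it suffices to bracket to the left. There are no 0-fold products, as there need
  not be a unit; hence the set is empty for \<open>n = 0\<close>.
\<close>

definition fold_products :: "nat \<Rightarrow> 'b set" where
  "fold_products n =
     {foldl prd x xs | x xs. x \<in> carrier A \<and> set xs \<subseteq> carrier A \<and> Suc (length xs) = n}"

definition algebra_power :: "nat \<Rightarrow> 'b set" where
  "algebra_power n = generated_ideal (fold_products n)"

text \<open>
  The condition \<open>n \<ge> 1\<close> is essential: \<open>algebra_power 0\<close> is the ideal generated by the empty set,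
  which is zero in every algebra.
\<close>

definition nilpotent :: bool where
  "nilpotent \<longleftrightarrow> (\<exists>n \<ge> 1. algebra_power n = {\<zero>\<^bsub>A\<^esub>})"

end

end

theory Submission
  imports Defs
begin

text \<open>
  If \<open>\<turnstile>\<close> and \<open>\<stileturn>\<close> are both the zero product, then both sides of every axiom except (A3)
  vanish, and the only remaining condition is that \<open>\<perp>\<close> is associative. So every associative algebra carries a
  triassociative structure whose \<open>\<perp>\<close> is the given product, while \<open>\<turnstile>\<close> and \<open>\<stileturn>\<close> are trivially
  nilpotent: all products of two factors are zero
  (\<open>triassociative_zero_products\<close>, \<open>zero_product_nilpotent\<close>).

  It thus suffices to have a non-nilpotent associative algebra. A nonzero idempotent is an \<open>n\<close>-fold
  product of itself for every \<open>n \<ge> 1\<close>, so it lies in every power of the algebra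
  (\<open>idempotent_not_nilpotent\<close>). The algebra of sequences over \<open>K\<close> with pointwise multiplication
  has one, namely its unit.
\<close>

context bilinear_product
begin

text \<open>Biadditivity determines the products with zero, since \<open>\<zero> = \<zero> \<oplus> \<zero>\<close>.\<close>

lemma prd_zero_left:
  assumes "y \<in> carrier A"
  shows "prd \<zero>\<^bsub>A\<^esub> y = \<zero>\<^bsub>A\<^esub>"
proof -
  have "prd \<zero>\<^bsub>A\<^esub> y \<oplus>\<^bsub>A\<^esub> prd \<zero>\<^bsub>A\<^esub> y = prd \<zero>\<^bsub>A\<^esub> y"
    using add_left[of "\<zero>\<^bsub>A\<^esub>" "\<zero>\<^bsub>A\<^esub>" y] assms by simp
  then show ?thesis
    using closed[of "\<zero>\<^bsub>A\<^esub>" y] assms by (simp add: M.add.l_cancel_one)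
qed

lemma prd_zero_right:
  assumes "x \<in> carrier A"
  shows "prd x \<zero>\<^bsub>A\<^esub> = \<zero>\<^bsub>A\<^esub>"
proof -
  have "prd x \<zero>\<^bsub>A\<^esub> \<oplus>\<^bsub>A\<^esub> prd x \<zero>\<^bsub>A\<^esub> = prd x \<zero>\<^bsub>A\<^esub>"
    using add_right[of x "\<zero>\<^bsub>A\<^esub>" "\<zero>\<^bsub>A\<^esub>"] assms by simp
  then show ?thesis
    using closed[of x "\<zero>\<^bsub>A\<^esub>"] assms by (simp add: M.add.l_cancel_one)
qed

end

context associative_algebra
begin

lemma zero_algebra_ideal: "algebra_ideal {\<zero>\<^bsub>A\<^esub>}"
  unfolding algebra_ideal_def
proof
  show "submodule {\<zero>\<^bsub>A\<^esub>} K A"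
    by (intro submodule.intro submodule_axioms.intro M.add.triv_subgroup[simplified])
      (auto simp: smult_r_null)
qed (simp add: prd_zero_left prd_zero_right)

lemma zero_in_algebra_ideal:
  assumes "algebra_ideal I"
  shows "\<zero>\<^bsub>A\<^esub> \<in> I"
proof -
  interpret submodule I K A
    using assms by (simp add: algebra_ideal_def)
  show ?thesis
    using one_closed by simp
qed

lemma zero_product_nilpotent:
  assumes "\<And>x y. \<lbrakk>x \<in> carrier A; y \<in> carrier A\<rbrakk> \<Longrightarrow> prd x y = \<zero>\<^bsub>A\<^esub>"
  shows nilpotent
proof -
  have "fold_products 2 \<subseteq> {\<zero>\<^bsub>A\<^esub>}"
    using assms by (auto simp: fold_products_def numeral_2_eq_2 length_Suc_conv)
  then have "algebra_power 2 = {\<zero>\<^bsub>A\<^esub>}"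
    using zero_algebra_ideal zero_in_algebra_ideal
    unfolding algebra_power_def generated_ideal_def by blast
  then show ?thesis
    unfolding nilpotent_def by (intro exI[of _ 2]) simp
qed

lemma idempotent_not_nilpotent:
  assumes e: "e \<in> carrier A" "e \<noteq> \<zero>\<^bsub>A\<^esub>" "prd e e = e"
  shows "\<not> nilpotent"
proof
  assume nilpotent
  then obtain n where n: "n \<ge> 1" "algebra_power n = {\<zero>\<^bsub>A\<^esub>}"
    unfolding nilpotent_def by blast
  have "foldl prd e (replicate k e) = e" for k
    by (induction k) (simp_all add: e)
  then have "e \<in> fold_products n"
    unfolding fold_products_def using e n(1)
    by (intro CollectI exI[of _ e] exI[of _ "replicate (n - 1) e"]) auto
  then have "e \<in> algebra_power n"
    unfolding algebra_power_def generated_ideal_def by blast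
  with n(2) e(2) show False
    by simp
qed

lemma zero_bilinear_product: "bilinear_product K A (\<lambda>_ _. \<zero>\<^bsub>A\<^esub>)"
  by (intro bilinear_product.intro bilinear_product_axioms.intro vector_space_over_axioms)
    (simp_all add: smult_r_null)

lemma triassociative_zero_products:
  "triassociative_algebra K A (\<lambda>_ _. \<zero>\<^bsub>A\<^esub>) (\<lambda>_ _. \<zero>\<^bsub>A\<^esub>) prd"
  by (intro triassociative_algebra.intro triassociative_algebra_axioms.intro
      vector_space_over_axioms bilinear_product_axioms zero_bilinear_product)
    (simp_all add: assoc prd_zero_left prd_zero_right)

end

text \<open>
  The record fields \<open>mult\<close> and \<open>one\<close> carry the algebra product used for \<open>\<perp>\<close> and the idempotent
  that keeps it from being nilpotent.
\<close>

definition seq_space :: "('k, 'm) ring_scheme \<Rightarrow> ('k, nat \<Rightarrow> 'k) module" where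
  "seq_space K =
     \<lparr>carrier = {f. \<forall>i. f i \<in> carrier K},
      mult = (\<lambda>f g i. f i \<otimes>\<^bsub>K\<^esub> g i), one = (\<lambda>_. \<one>\<^bsub>K\<^esub>),
      zero = (\<lambda>_. \<zero>\<^bsub>K\<^esub>), add = (\<lambda>f g i. f i \<oplus>\<^bsub>K\<^esub> g i),
      smult = (\<lambda>a f i. a \<otimes>\<^bsub>K\<^esub> f i)\<rparr>"

lemma seq_space_vector_space:
  assumes "field K"
  shows "vector_space_over K (seq_space K)"
proof -
  interpret field K by fact
  have "abelian_group (seq_space K)"
  proof (rule abelian_groupI)
    fix f assume "f \<in> carrier (seq_space K)"
    then show "\<exists>g \<in> carrier (seq_space K). g \<oplus>\<^bsub>seq_space K\<^esub> f = \<zero>\<^bsub>seq_space K\<^esub>"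
      by (intro bexI[of _ "\<lambda>i. \<ominus>\<^bsub>K\<^esub> f i"]) (auto simp: seq_space_def l_neg)
  qed (auto simp: seq_space_def a_ac)
  then show ?thesis
    by (intro vector_space_over.intro module.intro module_axioms.intro assms is_cring)
      (auto simp: seq_space_def l_distr r_distr m_assoc)
qed

lemma seq_space_associative_algebra:
  assumes "field K"
  shows "associative_algebra K (seq_space K) (mult (seq_space K))"
proof -
  interpret field K by fact
  show ?thesis
    by (intro associative_algebra.intro associative_algebra_axioms.intro
        bilinear_product.intro bilinear_product_axioms.intro seq_space_vector_space assms)
      (auto simp: seq_space_def l_distr r_distr m_ac)
qed

theorem mainTheorem3:
  fixes K :: "('k, 'm) ring_scheme"
  assumes "field K"
  shows "\<exists>(T :: ('k, nat \<Rightarrow> 'k) module) lprd rprd pprd.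
    triassociative_algebra K T lprd rprd pprd \<and>
    associative_algebra.nilpotent K T lprd \<and>
    associative_algebra.nilpotent K T rprd \<and>
    \<not> associative_algebra.nilpotent K T pprd"
proof -
  interpret field K by fact
  let ?T = "seq_space K"
  let ?null = "\<lambda>_ _. \<zero>\<^bsub>?T\<^esub>"
  interpret A: associative_algebra K ?T "mult ?T"
    by (rule seq_space_associative_algebra) fact
  have tri: "triassociative_algebra K ?T ?null ?null (mult ?T)"
    by (rule A.triassociative_zero_products)
  interpret N: associative_algebra K ?T ?null
    by (rule triassociative_algebra.associative_lprd) (rule tri)
  have "N.nilpotent"
    by (rule N.zero_product_nilpotent) simp
  moreover have "\<not> A.nilpotent"
    by (rule A.idempotent_not_nilpotent[of "\<one>\<^bsub>?T\<^esub>"]) (auto simp: seq_space_def fun_eq_iff)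
  ultimately show ?thesis
    using tri by blast
qed

end
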